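(* Let $H$ be a Dedekind-finite, non-torsion monoid. Then neither $\mathcal P_{\rm fin}(H)$ nor $\mathcal P_{{\rm fin},\times}(H)$ is equimorphic to a cancellative monoid. In particular, neither is a transfer Krull monoid.
   Context: Monoids are written multiplicatively and need not be commutative or cancellative; homomorphisms preserve the identity; for a monoid $M$, $M^\times$ is its set of units; $\mathbf N^+$ is the set of positive integers. A monoid is cancellative if $xz=yz$ or $zx=zy$ implies $x=y$. $H$ is Dedekind-finite if $xy=1_H$ implies $yx=1_H$; non-torsion if for some $x\in H$ the set $\{x^n:n\in\mathbf N^+\}$ is infinite. $\mathcal P_{\rm fin}(H)$ is the monoid of all non-empty finite subsets of $H$ with $XY := \{xy: x\in X,y\in Y\}$ and identity $\{1_H\}$; $\mathcal P_{{\rm fin},\times}(H)$ is its submonoid of those $X$ with $X\cap H^\times\neq\emptyset$. For a monoid $M$: an atom of $M$ is an element $a\notin M^\times$ such that there are no $x,y\in M\setminus M^\times$ with $a=xy$; $\mathscr A(M)$ is the set of atoms; $x\simeq_M y$ means $y\in M^\times xM^\times$. $\mathscr F^\ast(S)$ is the free monoid of words over $S$ (operation $\ast$), $\|\mathfrak a\|_M$ is the length of $\mathfrak a \in \mathscr F^\ast(M)$, $\pi_M:\mathscr F^\ast(M)\to M$ is the homomorphism with $\pi_M(x)=x$ for $x\in M$, and $\mathcal Z_M(x):=\{\mathfrak a\in\mathscr F^\ast(\mathscr A(M)):\pi_M(\mathfrak a)=x\}$. $\mathscr C_M$ is the congruence on $\mathscr F^\ast(\mathscr A(M))$ under which the empty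 word is related only to itself and non-empty words $a_1\ast\cdots\ast a_m$, $b_1\ast\cdots\ast b_n$ are related iff they have the same image under $\pi_M$, $m=n$, and $a_i\simeq_M b_{\sigma(i)}$ for all $i$, for some permutation $\sigma$ of $\{1,\dots,n\}$; $\llbracket\mathfrak b\rrbracket_{\mathscr C_M}$ is the class of $\mathfrak b$. A homomorphism $\varphi:M\to K$, with letterwise extension $\varphi^\ast:\mathscr F^\ast(M)\to\mathscr F^\ast(K)$, is an equimorphism if: (E1) $\varphi^{-1}(K^\times)\subseteq M^\times$; (E2) $\varphi(a)\in\mathscr A(K)$ for all $a\in\mathscr A(M)$; (E3) if $x\in M$, $\mathfrak b\in\mathcal Z_K(\varphi(x))\ne\emptyset$ and $\|\mathfrak b\|_K\ne0$, then $\varphi^\ast(\mathfrak a)\in\llbracket\mathfrak b\rrbracket_{\mathscr C_K}$ for some $\mathfrak a\in\mathcal Z_M(x)$. It is a weak transfer homomorphism if, in addition, $K=K^\times\varphi(M)K^\times$. $M$ is equimorphic to $K$ if there is an equimorphism from $M$ to $K$. $M$ is a transfer Krull monoid if there is a weak transfer homomorphism from $M$ to a monoid of zero-sum sequences over an abelian group $G$ with support in a subset $G_0\subseteq G$, i.e. the submonoid of the free abelian monoid on $G_0$ consisting of the formal products $g_1\cdots g_k$ ($k\ge0$, $g_i\in G_0$) with $g_1+\cdots+g_k=0$ in $G$. *)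

theory Defs
  imports "HOL-Algebra.Divisibility" "HOL-Algebra.FiniteProduct" "HOL-Library.Multiset"
begin

section \<open>Monoids and power monoids\<close>

definition dedekind_finite :: "('a, 'b) monoid_scheme \<Rightarrow> bool" where
  "dedekind_finite H \<longleftrightarrow>
     (\<forall>x\<in>carrier H. \<forall>y\<in>carrier H. x \<otimes>\<^bsub>H\<^esub> y = \<one>\<^bsub>H\<^esub> \<longrightarrow> y \<otimes>\<^bsub>H\<^esub> x = \<one>\<^bsub>H\<^esub>)"

definition non_torsion :: "('a, 'b) monoid_scheme \<Rightarrow> bool" where
  "non_torsion H \<longleftrightarrow> (\<exists>x\<in>carrier H. infinite {x [^]\<^bsub>H\<^esub> n | n::nat. n > 0})"

definition Pfin :: "('a, 'b) monoid_scheme \<Rightarrow> 'a set monoid" where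
  "Pfin H =
     \<lparr>carrier = {X. X \<subseteq> carrier H \<and> finite X \<and> X \<noteq> {}},
      mult = (\<lambda>X Y. X <#>\<^bsub>H\<^esub> Y),
      one = {\<one>\<^bsub>H\<^esub>}\<rparr>"

definition Pfin_units :: "('a, 'b) monoid_scheme \<Rightarrow> 'a set monoid" where
  "Pfin_units H = (Pfin H)\<lparr>carrier := {X \<in> carrier (Pfin H). X \<inter> Units H \<noteq> {}}\<rparr>"

section \<open>Atoms and factorizations\<close>

text \<open>In the non-commutative setting this differs from the library's \<open>irreducible\<close>, which is
  phrased through one-sided divisibility.\<close>

definition atoms :: "('a, 'b) monoid_scheme \<Rightarrow> 'a set" where
  "atoms M = {a \<in> carrier M - Units M.
     \<not> (\<exists>x \<in> carrier M - Units M. \<exists>y \<in> carrier M - Units M. a = x \<otimes>\<^bsub>M\<^esub> y)}"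

definition unit_equiv :: "('a, 'b) monoid_scheme \<Rightarrow> 'a \<Rightarrow> 'a \<Rightarrow> bool" where
  "unit_equiv M x y \<longleftrightarrow> y \<in> Units M <#>\<^bsub>M\<^esub> {x} <#>\<^bsub>M\<^esub> Units M"

text \<open>Words over a set \<open>S\<close> are the elements of \<open>lists S\<close>, with concatenation as operation.\<close>

definition word_prod :: "('a, 'b) monoid_scheme \<Rightarrow> 'a list \<Rightarrow> 'a" where
  "word_prod M w = foldr (\<otimes>\<^bsub>M\<^esub>) w \<one>\<^bsub>M\<^esub>"

definition factorizations :: "('a, 'b) monoid_scheme \<Rightarrow> 'a \<Rightarrow> 'a list set" where
  "factorizations M x = {w \<in> lists (atoms M). word_prod M w = x}"

definition fact_cong :: "('a, 'b) monoid_scheme \<Rightarrow> ('a list \<times> 'a list) set" where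
  "fact_cong M = {(a, b). a \<in> lists (atoms M) \<and> b \<in> lists (atoms M) \<and>
     (a = [] \<and> b = [] \<or>
      a \<noteq> [] \<and> b \<noteq> [] \<and> word_prod M a = word_prod M b \<and> length a = length b \<and>
      (\<exists>\<sigma>. \<sigma> permutes {..<length b} \<and> (\<forall>i<length b. unit_equiv M (a ! i) (b ! \<sigma> i))))}"

section \<open>Equimorphisms and transfer Krull monoids\<close>

text \<open>The library's \<open>hom\<close> does not require preservation of the identity.\<close>

definition monoid_hom :: "('a, 'b) monoid_scheme \<Rightarrow> ('c, 'd) monoid_scheme \<Rightarrow> ('a \<Rightarrow> 'c) \<Rightarrow> bool" where
  "monoid_hom M K \<phi> \<longleftrightarrow> \<phi> \<in> hom M K \<and> \<phi> \<one>\<^bsub>M\<^esub> = \<one>\<^bsub>K\<^esub>"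

definition equimorphism :: "('a, 'b) monoid_scheme \<Rightarrow> ('c, 'd) monoid_scheme \<Rightarrow> ('a \<Rightarrow> 'c) \<Rightarrow> bool" where
  "equimorphism M K \<phi> \<longleftrightarrow> monoid_hom M K \<phi> \<and>
     (\<forall>x\<in>carrier M. \<phi> x \<in> Units K \<longrightarrow> x \<in> Units M) \<and>
     (\<forall>a\<in>atoms M. \<phi> a \<in> atoms K) \<and>
     (\<forall>x\<in>carrier M. \<forall>b\<in>factorizations K (\<phi> x). length b \<noteq> 0 \<longrightarrow>
        (\<exists>a\<in>factorizations M x. map \<phi> a \<in> fact_cong K `` {b}))"

definition weak_transfer_hom :: "('a, 'b) monoid_scheme \<Rightarrow> ('c, 'd) monoid_scheme \<Rightarrow> ('a \<Rightarrow> 'c) \<Rightarrow> bool" where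
  "weak_transfer_hom M K \<phi> \<longleftrightarrow> equimorphism M K \<phi> \<and>
     carrier K = Units K <#>\<^bsub>K\<^esub> (\<phi> ` carrier M) <#>\<^bsub>K\<^esub> Units K"

definition equimorphic :: "('a, 'b) monoid_scheme \<Rightarrow> ('c, 'd) monoid_scheme \<Rightarrow> bool" where
  "equimorphic M K \<longleftrightarrow> (\<exists>\<phi>. equimorphism M K \<phi>)"

text \<open>The free abelian monoid on \<open>G0\<close> consists of the multisets with elements in \<open>G0\<close>. The abelian
  group \<open>G\<close> is written multiplicatively, as \<open>comm_group\<close> prescribes, so that the sum of the terms
  of a sequence appears as a product, and \<open>0\<close> as \<open>\<one>\<close>.\<close>

definition zero_sum_monoid :: "('g, 'b) monoid_scheme \<Rightarrow> 'g set \<Rightarrow> 'g multiset monoid" where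
  "zero_sum_monoid G G0 =
     \<lparr>carrier = {A. set_mset A \<subseteq> G0 \<and> (\<Otimes>\<^bsub>G\<^esub>g\<in>set_mset A. g [^]\<^bsub>G\<^esub> count A g) = \<one>\<^bsub>G\<^esub>},
      mult = (+),
      one = {#}\<rparr>"

text \<open>A definition cannot quantify over types, so the type of elements of the group is a parameter;
  not being transfer Krull means that \<open>\<not> transfer_Krull TYPE('g) M\<close> holds for every type \<open>'g\<close>.\<close>

definition transfer_Krull :: "'g itself \<Rightarrow> ('a, 'b) monoid_scheme \<Rightarrow> bool" where
  "transfer_Krull (_ :: 'g itself) M \<longleftrightarrow>
     (\<exists>(G :: 'g monoid) G0 \<phi>. comm_group G \<and> G0 \<subseteq> carrier G \<and>
        weak_transfer_hom M (zero_sum_monoid G G0) \<phi>)"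

section \<open>Basic facts\<close>

lemma monoid_Pfin:
  assumes "monoid H"
  shows "monoid (Pfin H)"
proof -
  interpret monoid H by fact
  show ?thesis
  proof (rule monoidI, goal_cases)
    case (1 X Y)
    then show ?case by (fastforce simp: Pfin_def set_mult_def)
  next
    case (3 X Y Z)
    then have sub: "X \<subseteq> carrier H" "Y \<subseteq> carrier H" "Z \<subseteq> carrier H"
      by (auto simp: Pfin_def)
    have "(X <#>\<^bsub>H\<^esub> Y) <#>\<^bsub>H\<^esub> Z = (\<Union>x\<in>X. \<Union>y\<in>Y. \<Union>z\<in>Z. {x \<otimes>\<^bsub>H\<^esub> y \<otimes>\<^bsub>H\<^esub> z})"
      by (simp add: set_mult_def)
    also have "\<dots> = (\<Union>x\<in>X. \<Union>y\<in>Y. \<Union>z\<in>Z. {x \<otimes>\<^bsub>H\<^esub> (y \<otimes>\<^bsub>H\<^esub> z)})"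
      using sub by (intro SUP_cong refl) (simp add: m_assoc subset_iff)
    also have "\<dots> = X <#>\<^bsub>H\<^esub> (Y <#>\<^bsub>H\<^esub> Z)"
      by (simp add: set_mult_def)
    finally show ?case by (simp add: Pfin_def)
  qed (auto simp: Pfin_def set_mult_def subset_iff)
qed

lemma monoid_Pfin_units:
  assumes "monoid H"
  shows "monoid (Pfin_units H)"
proof -
  interpret monoid H by fact
  interpret P: monoid "Pfin H" by (rule monoid_Pfin) fact
  show ?thesis
  proof (rule monoidI, goal_cases)
    case (1 X Y)
    then obtain x y where "x \<in> X" "x \<in> Units H" "y \<in> Y" "y \<in> Units H"
      by (auto simp: Pfin_units_def)
    then have "x \<otimes>\<^bsub>H\<^esub> y \<in> (X <#>\<^bsub>H\<^esub> Y) \<inter> Units H" by (auto simp: set_mult_def)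
    moreover have "X \<otimes>\<^bsub>Pfin H\<^esub> Y \<in> carrier (Pfin H)"
      using 1 by (intro P.m_closed) (auto simp: Pfin_units_def)
    ultimately show ?case by (auto simp: Pfin_units_def Pfin_def)
  next
    case 2
    then show ?case using P.one_closed by (auto simp: Pfin_units_def Pfin_def)
  next
    case (3 X Y Z)
    then show ?case using P.m_assoc by (auto simp: Pfin_units_def)
  qed (use P.l_one P.r_one in \<open>auto simp: Pfin_units_def\<close>)
qed

end

theory Submission
  imports Defs
begin

text \<open>Let \<open>x\<close> have infinite order. In either power monoid
  \<open>{1, x}\<^sup>3 = {1, x, x\<^sup>2, x\<^sup>3} = {1, x} {1, x\<^sup>2}\<close>, and so an equimorphism \<open>\<phi>\<close> to a cancellative
  monoid satisfies \<open>\<phi> {1, x}\<^sup>2 = \<phi> {1, x\<^sup>2}\<close>. But \<open>{1, x\<^sup>2}\<close> is an atom while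
  \<open>{1, x}\<close> is not a unit: conditions (E1) and (E2) are contradicted.\<close>

text \<open>A coincidence \<open>x [^] i = x [^] j\<close> lets every exponent
  \<open>n \<ge> j\<close> be lowered to \<open>i + (n - j) < n\<close>. By strong induction all
  powers of \<open>x\<close> then lie among the first \<open>j\<close>, a finite set.\<close>

lemma (in monoid) pow_neq_if_infinite_powers:
  assumes x: "x \<in> carrier G" and inf: "infinite {x [^] n | n::nat. n > 0}" and "i < j"
  shows "x [^] i \<noteq> x [^] (j::nat)"
proof
  assume eq: "x [^] i = x [^] j"
  have "x [^] n \<in> (\<lambda>k. x [^] k) ` {..<j}" for n :: nat
  proof (induction n rule: less_induct)
    case (less n)
    show ?case
    proof (cases "n < j")
      case False
      have "x [^] n = x [^] j \<otimes> x [^] (n - j)"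
        using False x by (simp add: nat_pow_mult)
      also have "\<dots> = x [^] (i + (n - j))"
        using x by (simp flip: eq add: nat_pow_mult)
      finally show ?thesis
        using less.IH[of "i + (n - j)"] False \<open>i < j\<close> by simp
    qed auto
  qed
  then have "{x [^] n | n::nat. n > 0} \<subseteq> (\<lambda>k. x [^] k) ` {..<j}" by blast
  with inf show False using finite_subset by blast
qed

lemma (in monoid) dedekind_finite_inverse_in_Units:
  assumes "dedekind_finite G" "x \<in> carrier G" "y \<in> carrier G" "x \<otimes> y = \<one>"
  shows "y \<otimes> x = \<one>" "x \<in> Units G" "y \<in> Units G"
  using assms unfolding dedekind_finite_def Units_def by blast+

text \<open>This allows both power monoids to be treated by one argument. The lower bound on the
  carrier makes every finite set containing \<open>\<one>\<close> available.\<close>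

definition power_submonoid :: "('a, 'b) monoid_scheme \<Rightarrow> 'a set monoid \<Rightarrow> bool" where
  "power_submonoid H P \<longleftrightarrow>
     carrier (Pfin_units H) \<subseteq> carrier P \<and> carrier P \<subseteq> carrier (Pfin H) \<and>
     mult P = mult (Pfin H) \<and> one P = one (Pfin H)"

lemma power_submonoid_Pfin: "power_submonoid H (Pfin H)"
  by (auto simp: power_submonoid_def Pfin_units_def)

lemma power_submonoid_Pfin_units: "power_submonoid H (Pfin_units H)"
  by (auto simp: power_submonoid_def Pfin_units_def)

lemma power_submonoid_carrierD:
  "power_submonoid H P \<Longrightarrow> X \<in> carrier P \<Longrightarrow> X \<subseteq> carrier H \<and> finite X \<and> X \<noteq> {}"
  by (auto simp: power_submonoid_def Pfin_def)

lemma power_submonoid_carrierI: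
  "power_submonoid H P \<Longrightarrow> X \<subseteq> carrier H \<Longrightarrow> finite X \<Longrightarrow> X \<inter> Units H \<noteq> {} \<Longrightarrow> X \<in> carrier P"
  by (auto simp: power_submonoid_def Pfin_units_def Pfin_def)

lemma power_submonoid_mult: "power_submonoid H P \<Longrightarrow> X \<otimes>\<^bsub>P\<^esub> Y = X <#>\<^bsub>H\<^esub> Y"
  by (simp add: power_submonoid_def Pfin_def)

lemma power_submonoid_one: "power_submonoid H P \<Longrightarrow> \<one>\<^bsub>P\<^esub> = {\<one>\<^bsub>H\<^esub>}"
  by (simp add: power_submonoid_def Pfin_def)

text \<open>If \<open>X <#> Y = {\<one>}\<close>, then all elements of \<open>X\<close> are left
  inverses of one fixed \<open>y\<close> in \<open>Y\<close>. Dedekind-finiteness makes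
  \<open>y\<close> a unit, so \<open>X\<close> collapses to \<open>{inv y}\<close>.\<close>

lemma (in monoid) power_submonoid_Units:
  assumes df: "dedekind_finite G" and P: "power_submonoid G P"
  shows "Units P = (\<lambda>u. {u}) ` Units G"
proof (intro equalityI subsetI)
  fix X assume "X \<in> Units P"
  then obtain Y where X: "X \<in> carrier P" and Y: "Y \<in> carrier P"
    and XY: "X <#> Y = {\<one>}"
    by (auto simp: Units_def power_submonoid_mult[OF P] power_submonoid_one[OF P])
  note sub = power_submonoid_carrierD[OF P X] power_submonoid_carrierD[OF P Y]
  then obtain y where y: "y \<in> Y" "y \<in> carrier G" by blast
  have inv: "x \<in> Units G \<and> x = inv y" if "x \<in> X" for x
  proof -
    have "x \<otimes> y = \<one>" using that y(1) XY unfolding set_mult_def by blast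
    moreover have "x \<in> carrier G" using that sub by blast
    ultimately show ?thesis
      using dedekind_finite_inverse_in_Units[OF df, of x y] y inv_unique[of x y "inv y"] by simp
  qed
  then have "X = {inv y}" "inv y \<in> Units G" using sub by blast+
  then show "X \<in> (\<lambda>u. {u}) ` Units G" by blast
next
  fix X assume "X \<in> (\<lambda>u. {u}) ` Units G"
  then obtain u where u: "u \<in> Units G" "X = {u}" by blast
  have "{u} \<in> carrier P" "{inv u} \<in> carrier P"
    using u by (auto intro!: power_submonoid_carrierI[OF P])
  moreover have "{u} <#> {inv u} = {\<one>}" "{inv u} <#> {u} = {\<one>}"
    using u by (auto simp: set_mult_def)
  ultimately show "X \<in> Units P"
    using u unfolding Units_def
    by (auto simp: power_submonoid_mult[OF P] power_submonoid_one[OF P])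
qed

text \<open>The conditions on \<open>z \<otimes> z\<close> are sharp: if it were
  \<open>\<one>\<close> or \<open>z\<close>, the non-unit \<open>{\<one>, z}\<close> would be its
  own square.\<close>

lemma (in monoid) pair_in_atoms:
  assumes df: "dedekind_finite G" and P: "power_submonoid G P"
    and z: "z \<in> carrier G" and z1: "z \<noteq> \<one>" and zz: "z \<otimes> z \<noteq> \<one>" "z \<otimes> z \<noteq> z"
  shows "{\<one>, z} \<in> atoms P"
proof -
  have U: "Units P = (\<lambda>u. {u}) ` Units G" by (rule power_submonoid_Units[OF df P])
  have carr: "{\<one>, z} \<in> carrier P"
    using z by (auto intro!: power_submonoid_carrierI[OF P])
  have nonunit: "{\<one>, z} \<notin> Units P" using z1 unfolding U by (auto simp: doubleton_eq_iff)
  have "A \<in> Units P \<or> B \<in> Units P"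
    if A: "A \<in> carrier P" and B: "B \<in> carrier P" and AB: "{\<one>, z} = A \<otimes>\<^bsub>P\<^esub> B" for A B
  proof -
    note sub = power_submonoid_carrierD[OF P A] power_submonoid_carrierD[OF P B]
    have AB': "A <#> B = {\<one>, z}" using AB by (simp add: power_submonoid_mult[OF P])
    then have "\<one> \<in> A <#> B" by simp
    then obtain a b where ab: "a \<in> A" "b \<in> B" "a \<otimes> b = \<one>"
      by (auto simp: set_mult_def)
    have ac: "a \<in> carrier G" and bc: "b \<in> carrier G" using ab sub by auto
    have ba: "b \<otimes> a = \<one>" "a \<in> Units G" "b \<in> Units G"
      using dedekind_finite_inverse_in_Units[OF df ac bc ab(3)] by auto
    \<comment> \<open>As \<open>A B = (A b) (a B)\<close> with \<open>1\<close> in both factors, \<open>A b\<close> and \<open>a B\<close> are subsets of \<open>{1, z}\<close>;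
      they are not both equal to it, since \<open>z\<^sup>2\<close> is not in \<open>{1, z}\<close>.\<close>
    have prod: "p \<otimes> q \<in> {\<one>, z}" if "p \<in> A" "q \<in> B" for p q
      unfolding AB'[symmetric] using that by (auto simp: set_mult_def)
    have not_both: "\<not> (p \<otimes> b = z \<and> a \<otimes> q = z)" if pq: "p \<in> A" "q \<in> B" for p q
    proof
      assume eq: "p \<otimes> b = z \<and> a \<otimes> q = z"
      have pc: "p \<in> carrier G" and qc: "q \<in> carrier G" using pq sub by auto
      \<comment> \<open>Here Dedekind-finiteness enters: the inner factor
        \<open>b \<otimes> a\<close> is \<open>\<one>\<close>, so \<open>z \<otimes> z\<close> would
        be \<open>p \<otimes> q\<close>, an element of \<open>A <#> B\<close>.\<close>
      have "z \<otimes> z = (p \<otimes> b) \<otimes> (a \<otimes> q)" using eq by simp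
      also have "\<dots> = p \<otimes> ((b \<otimes> a) \<otimes> q)" using ac bc pc qc by (simp add: m_assoc)
      also have "\<dots> = p \<otimes> q" using ba(1) qc by simp
      finally show False using prod[OF pq] zz by auto
    qed
    \<comment> \<open>Each \<open>p \<otimes> b\<close> and each \<open>a \<otimes> q\<close> is
      \<open>\<one>\<close> or \<open>z\<close>, so a failure of both alternatives would yield a
      pair forbidden by \<open>not_both\<close>. In either case uniqueness of inverses shrinks one
      factor to a singleton unit.\<close>
    have "(\<forall>p\<in>A. p \<otimes> b = \<one>) \<or> (\<forall>q\<in>B. a \<otimes> q = \<one>)"
      using prod ab not_both by blast
    then show ?thesis
    proof
      assume *: "\<forall>p\<in>A. p \<otimes> b = \<one>"
      have "p = a" if "p \<in> A" for p
      proof -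
        have "p \<in> carrier G" using that sub by auto
        then show ?thesis
          using inv_unique[of p b a] * that ba ac bc by auto
      qed
      then have "A = {a}" using ab by blast
      then show ?thesis using ba U by blast
    next
      assume *: "\<forall>q\<in>B. a \<otimes> q = \<one>"
      have "q = b" if "q \<in> B" for q
      proof -
        have "q \<in> carrier G" using that sub by auto
        then show ?thesis using inv_unique[of b a q] * that ba ac bc by auto
      qed
      then have "B = {b}" using ab by blast
      then show ?thesis using ba U by blast
    qed
  qed
  then show ?thesis using carr nonunit unfolding atoms_def by blast
qed

text \<open>Cancellation in \<open>K\<close> is stated as a rule on its carrier, so that it can be
  supplied either by \<open>monoid_cancel\<close> or directly by the addition of multisets.\<close>

lemma (in monoid) no_equimorphism_left_cancel:
  fixes K :: "('k, 'c) monoid_scheme"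
  assumes df: "dedekind_finite G" and nt: "non_torsion G" and P: "power_submonoid G P"
    and cancel: "\<And>u v w. \<lbrakk>u \<in> carrier K; v \<in> carrier K; w \<in> carrier K;
      w \<otimes>\<^bsub>K\<^esub> u = w \<otimes>\<^bsub>K\<^esub> v\<rbrakk> \<Longrightarrow> u = v"
  shows "\<not> equimorphism P K \<phi>"
proof
  assume eq: "equimorphism P K \<phi>"
  obtain x where x: "x \<in> carrier G" and inf: "infinite {x [^] n | n::nat. n > 0}"
    using nt unfolding non_torsion_def by blast
  note neq = pow_neq_if_infinite_powers[OF x inf]
  define X where "X = {\<one>, x}"
  define Y where "Y = {\<one>, x \<otimes> x}"
  define Z where "Z = {\<one>, x, x \<otimes> x}"
  have carr: "X \<in> carrier P" "Y \<in> carrier P" "Z \<in> carrier P"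
    using x unfolding X_def Y_def Z_def by (auto intro!: power_submonoid_carrierI[OF P])
  have XX: "X \<otimes>\<^bsub>P\<^esub> X = Z" and XZ: "X \<otimes>\<^bsub>P\<^esub> Z = X \<otimes>\<^bsub>P\<^esub> Y"
    using x unfolding power_submonoid_mult[OF P] X_def Y_def Z_def set_mult_def
    by (auto simp: m_assoc)
  have "x \<noteq> \<one>" using neq[of 0 1] x by auto
  then have X_nonunit: "X \<notin> Units P"
    unfolding power_submonoid_Units[OF df P] X_def by (auto simp: doubleton_eq_iff)
  \<comment> \<open>For \<open>z = x \<otimes> x\<close> the conditions of
    \<open>pair_in_atoms\<close> say that the powers of \<open>x\<close> with exponents 0, 2 and 4
    are distinct.\<close>
  have pows: "x \<otimes> x = x [^] (2::nat)" "x \<otimes> x \<otimes> (x \<otimes> x) = x [^] (4::nat)"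
    using x by (simp_all add: numeral_eq_Suc m_assoc)
  have Y_atom: "Y \<in> atoms P"
    unfolding Y_def
  proof (rule pair_in_atoms[OF df P])
    show "x \<otimes> x \<noteq> \<one>" using neq[of 0 2] pows by auto
    show "x \<otimes> x \<otimes> (x \<otimes> x) \<noteq> \<one>" using neq[of 0 4] unfolding pows(2) by auto
    show "x \<otimes> x \<otimes> (x \<otimes> x) \<noteq> x \<otimes> x" using neq[of 2 4] unfolding pows(2) unfolding pows(1) by auto
  qed (use x in auto)
  have hom: "\<phi> \<in> hom P K" using eq by (simp add: equimorphism_def monoid_hom_def)
  then have carrK: "\<phi> X \<in> carrier K" "\<phi> Y \<in> carrier K" "\<phi> Z \<in> carrier K"
    using carr by (auto simp: hom_def)
  have "\<phi> X \<otimes>\<^bsub>K\<^esub> \<phi> Z = \<phi> X \<otimes>\<^bsub>K\<^esub> \<phi> Y"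
    using hom_mult[OF hom] carr XZ by metis
  then have "\<phi> Y = \<phi> X \<otimes>\<^bsub>K\<^esub> \<phi> X"
    using cancel carrK hom_mult[OF hom] carr XX by metis
  moreover have "\<phi> X \<in> carrier K - Units K"
    using eq X_nonunit carr carrK by (auto simp: equimorphism_def)
  moreover have "\<phi> Y \<in> atoms K" using eq Y_atom by (simp add: equimorphism_def)
  ultimately show False unfolding atoms_def by blast
qed

theorem proposition4p12:
  fixes H :: "('a, 'b) monoid_scheme"
  assumes "monoid H" and "dedekind_finite H" and "non_torsion H"
  shows "\<not> (\<exists>K :: 'k monoid. monoid_cancel K \<and> equimorphic (Pfin H) K) \<and>
         \<not> (\<exists>K :: 'k monoid. monoid_cancel K \<and> equimorphic (Pfin_units H) K) \<and>
         \<not> transfer_Krull TYPE('g) (Pfin H) \<and>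
         \<not> transfer_Krull TYPE('g) (Pfin_units H)"
proof -
  interpret monoid H by fact
  note none = no_equimorphism_left_cancel[OF assms(2,3)]
  have cancellative: "\<not> (\<exists>K :: 'k monoid. monoid_cancel K \<and> equimorphic P K)"
    if P: "power_submonoid H P" for P
  proof -
    have "\<not> equimorphism P K \<phi>" if "monoid_cancel K" for K :: "'k monoid" and \<phi>
      using monoid_cancel.l_cancel[OF that] by (intro none[OF P]) blast
    then show ?thesis unfolding equimorphic_def by blast
  qed
  have krull: "\<not> transfer_Krull TYPE('g) P" if P: "power_submonoid H P" for P
  proof -
    \<comment> \<open>The operation of \<open>zero_sum_monoid\<close> is multiset addition, which is
      cancellative whatever \<open>G\<close> and \<open>G0\<close> are.\<close>
    have "\<not> equimorphism P (zero_sum_monoid G G0) \<phi>" for G :: "'g monoid" and G0 \<phi>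
      by (rule none[OF P]) (simp add: zero_sum_monoid_def)
    then show ?thesis unfolding transfer_Krull_def weak_transfer_hom_def by blast
  qed
  show ?thesis
    using cancellative krull power_submonoid_Pfin power_submonoid_Pfin_units by blast
qed

end
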